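(* Let $A\in\mathbb{R}^{n\times n}$, $C=I\in\mathbb{R}^{n\times n}$, $N\ge1$, and let $L=W_o$ be the observability Gramian over horizon $N$, with eigendecomposition $L=V\Lambda V^\top$, where $V\in\mathbb{R}^{n\times n}$ is orthogonal, $\Lambda=\mathrm{diag}(\lambda_1,\dots,\lambda_n)$ and $\lambda_1\ge\dots\ge\lambda_n\ge0$. Then the marginal kernel, written as $$K=L(L+I)^{-1}=V\,\mathrm{diag}\Big(\frac{\lambda_1}{\lambda_1+1},\dots,\frac{\lambda_n}{\lambda_n+1}\Big)V^\top,$$ has the following properties. (i) The diagonal entry $K_{ii}=\mathbb{P}(i\in Y)$ is the marginal probability that node $i$ is included in a random subset $Y$ drawn from $\mathcal{P}_L$. (ii) The eigenvalues $\kappa_i=\lambda_i/(\lambda_i+1)\in[0,1)$ are the inclusion probabilities of the $i$-th observability mode, where mode $i$ is selected independently with probability $\kappa_i$. (iii) The expected number of selected nodes is given by $$\mathbb{E}[|Y|]=\mathrm{tr}(K)=\sum_{i=1}^n\frac{\lambda_i}{\lambda_i+1},$$ and the variance is $\mathrm{Var}[|Y|]=\sum_{i=1}^n\lambda_i/(\lambda_i+1)^2$.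
   Context: For the discrete-time linear system $x[k+1]=Ax[k]+Bu[k]$, $y[k]=Cx[k]$, the observability Gramian over horizon $N$ is $W_o=\sum_{k=0}^{N-1}(A^k)^\top C^\top CA^k\in\mathbb{R}^{n\times n}$; here $C=I$, so every state variable is a candidate node and the node set is $\mathcal{Y}=\{1,\dots,n\}$. For a matrix $M$ and an index set $S$, $M_S=[M_{ij}]_{i,j\in S}$ is the principal submatrix, with $\det(M_\emptyset)=1$. For symmetric $L\succeq0$ indexed by $\mathcal{Y}$, the L-ensemble determinantal point process (DPP) is the probability measure $\mathcal{P}_L(Y)=\det(L_Y)/\det(L+I)$ on $2^{\mathcal{Y}}$; its marginal kernel is $K:=L(L+I)^{-1}$. The eigenvectors $v_1,\dots,v_n$ of $L$ (the columns of $V$) are called the observability modes. Selection of a mode refers to the selection of the corresponding eigenvector in the standard spectral DPP sampling algorithm for drawing $Y\sim\mathcal{P}_L$. *)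

theory Defs
  imports "HOL-Probability.Probability"
begin

(* The power operation on type vec is componentwise, hence not usable for matrices. *)
definition matrix_pow :: "real^'n^'n \<Rightarrow> nat \<Rightarrow> real^'n^'n" where
  "matrix_pow A k = (((**) A) ^^ k) (mat 1)"

definition diag_matrix :: "('n \<Rightarrow> real) \<Rightarrow> real^'n^'n" where
  "diag_matrix d = (\<chi> i j. if i = j then d i else 0)"

definition observability_gramian :: "real^'n^'n \<Rightarrow> real^'n^'p \<Rightarrow> nat \<Rightarrow> real^'n^'n" where
  "observability_gramian A C N =
     (\<Sum>k<N. transpose (matrix_pow A k) ** transpose C ** C ** matrix_pow A k)"

(* The Leibniz formula of the library's det, with the index type replaced by the index set S. *)
definition principal_minor :: "real^'n^'n \<Rightarrow> 'n set \<Rightarrow> real" where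
  "principal_minor M S = (\<Sum>p | p permutes S. of_int (sign p) * (\<Prod>i\<in>S. M $ i $ p i))"

lemma principal_minor_empty: "principal_minor M {} = 1"
  by (simp add: principal_minor_def)

lemma principal_minor_UNIV: "principal_minor M UNIV = det M"
  by (simp add: principal_minor_def det_def)

(* The map into ennreal truncates negative values; for positive semidefinite L all the
   masses are nonnegative and nothing is truncated. *)
definition dpp :: "real^'n^'n \<Rightarrow> 'n set measure" where
  "dpp L = point_measure UNIV (\<lambda>Y. ennreal (principal_minor L Y / det (L + mat 1)))"

definition marginal_kernel :: "real^'n^'n \<Rightarrow> real^'n^'n" where
  "marginal_kernel L = L ** matrix_inv (L + mat 1)"

text \<open>
  The spectral sampling algorithm. First a random set J of modes is drawn by independent coin
  flips, mode i having success probability \<open>lam i / (lam i + 1)\<close>. Then, starting from the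
  eigenvectors \<open>B = {v\<^sub>j | j \<in> J}\<close> and the empty set of nodes, the following is repeated while B is
  nonempty: draw a node i with probability \<open>(\<Sum>v\<in>B. (v $ i)\<^sup>2) / card B\<close>, add it to the set of
  nodes, and replace B by an orthonormal basis of the subspace of \<open>span B\<close> orthogonal to the
  i-th standard basis vector.
\<close>

definition orthonormal :: "(real^'n) set \<Rightarrow> bool" where
  "orthonormal B \<longleftrightarrow> pairwise orthogonal B \<and> (\<forall>v\<in>B. norm v = 1)"

definition select_modes :: "('n::finite \<Rightarrow> real) \<Rightarrow> 'n set pmf" where
  "select_modes lam =
     map_pmf (\<lambda>b. {i. b i}) (Pi_pmf UNIV False (\<lambda>i. bernoulli_pmf (lam i / (lam i + 1))))"

definition pick_node :: "(real^'n) set \<Rightarrow> 'n pmf" where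
  "pick_node B = embed_pmf (\<lambda>i. (\<Sum>v\<in>B. (v $ i)\<^sup>2) / real (card B))"

lemma orthonormal_imp_finite: "orthonormal B \<Longrightarrow> finite B"
  unfolding orthonormal_def by (rule pairwise_orthogonal_imp_finite) simp

lemma pmf_pick_node:
  fixes B :: "(real^'n) set"
  assumes "orthonormal B" "B \<noteq> {}"
  shows "pmf (pick_node B) i = (\<Sum>v\<in>B. (v $ i)\<^sup>2) / real (card B)"
  unfolding pick_node_def
proof (rule pmf_embed_pmf)
  show "0 \<le> (\<Sum>v\<in>B. (v $ j)\<^sup>2) / real (card B)" for j
    by (intro divide_nonneg_nonneg sum_nonneg) auto
  have fin: "finite B" by (rule orthonormal_imp_finite[OF assms(1)])
  have sq: "(\<Sum>j\<in>UNIV. (v $ j)\<^sup>2) = 1" if "v \<in> B" for v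
  proof -
    have "(\<Sum>j\<in>UNIV. (v $ j)\<^sup>2) = (norm v)\<^sup>2"
      unfolding power2_norm_eq_inner by (simp add: inner_vec_def power2_eq_square)
    then show ?thesis using assms(1) that by (simp add: orthonormal_def)
  qed
  have "(\<Sum>j\<in>UNIV. (\<Sum>v\<in>B. (v $ j)\<^sup>2) / real (card B)) =
      (\<Sum>v\<in>B. \<Sum>j\<in>UNIV. (v $ j)\<^sup>2) / real (card B)"
    unfolding sum_divide_distrib[symmetric] by (subst sum.swap) (rule refl)
  also have "\<dots> = 1"
    using sq fin assms(2) by simp
  finally show "(\<integral>\<^sup>+ j. ennreal ((\<Sum>v\<in>B. (v $ j)\<^sup>2) / real (card B)) \<partial>count_space UNIV) = 1"
    by (simp add: nn_integral_count_space_finite sum_nonneg)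
qed

definition perp_basis :: "(real^'n) set \<Rightarrow> 'n \<Rightarrow> (real^'n) set" where
  "perp_basis B i = (SOME B'. orthonormal B' \<and> span B' = {x \<in> span B. orthogonal x (axis i 1)})"

lemma perp_basis:
  "orthonormal (perp_basis B i)"
  "span (perp_basis B i) = {x \<in> span B. orthogonal x (axis i 1)}"
proof -
  have S: "subspace {x \<in> span B. orthogonal x (axis i 1)}"
    by (simp add: subspace_def span_zero span_add span_scale orthogonal_def inner_add_left)
  have "\<exists>B'. orthonormal B' \<and> span B' = {x \<in> span B. orthogonal x (axis i 1)}"
    by (rule orthonormal_basis_subspace[OF S], unfold orthonormal_def) blast
  from someI_ex[OF this, folded perp_basis_def]
  show "orthonormal (perp_basis B i)"
    "span (perp_basis B i) = {x \<in> span B. orthogonal x (axis i 1)}" by blast+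
qed

(* The while loop is bounded by the first argument. Each round started with an orthonormal B
   decreases its cardinality by one almost surely, so CARD('n) rounds always suffice. *)
primrec sample_nodes :: "nat \<Rightarrow> (real^'n) set \<Rightarrow> 'n set \<Rightarrow> 'n set pmf" where
  "sample_nodes 0 B Y = return_pmf Y"
| "sample_nodes (Suc k) B Y =
     (if B = {} then return_pmf Y
      else bind_pmf (pick_node B) (\<lambda>i. sample_nodes k (perp_basis B i) (insert i Y)))"

(* The joint law of the selected set of modes and the sampled set of nodes, for the
   eigenvectors given by the columns of V and the eigenvalues lam. *)
definition spectral_sampler ::
    "real^'n^'n \<Rightarrow> ('n \<Rightarrow> real) \<Rightarrow> ('n set \<times> 'n set) pmf" where
  "spectral_sampler V lam =
     bind_pmf (select_modes lam) (\<lambda>J.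
       map_pmf (\<lambda>Y. (J, Y)) (sample_nodes CARD('n) ((\<lambda>j. column j V) ` J) {}))"

end

theory Submission
  imports Defs
begin

text \<open>
  A round of the sampler splits the projection to the span of the current basis into the projection
  for the next basis plus a rank-one term, and a Schur complement shows by induction that, started
  from an orthonormal set B with projection P, the sampler returns Y with probability
  \<open>det (P\<^sub>Y)\<close> if \<open>card Y = card B\<close> and 0 otherwise. Expanding \<open>det ((V diag(w) V\<^sup>T)\<^sub>Y)\<close>
  multilinearly gives a sum over injections f of Y into the modes in which w enters only through
  the product of the weights \<open>w (f i)\<close>. Comparing w = indicator J, averaged over the law of the
  random set J of modes, with w = lam identifies the law of the sampled nodes as the L-ensemble.
  Since the numbers of nodes and of modes agree almost surely, mean and variance of the size are
  those of a sum of independent Bernoulli variables.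
  The diagonal of K is obtained from the sum of all principal minors of a matrix M being
  \<open>det (M + I)\<close>, applied to L with its i-th row replaced by 0.
\<close>

section \<open>Principal minors and determinant identities\<close>

text \<open>Padding with unit rows turns minors over varying index sets into determinants of one
  fixed size, so that row operations apply to them. A permutation moving a point outside
  \<open>S\<close> meets an off-diagonal zero of a unit row.\<close>

lemma principal_minor_eq_det:
  "principal_minor M S = det (\<chi> i. if i \<in> S then row i M else axis i 1)" (is "_ = det ?N")
proof -
  have off: "(\<Prod>i\<in>UNIV. ?N $ i $ p i) = 0" if "p permutes UNIV" "\<not> p permutes S" for p
  proof -
    have "\<not> (\<forall>x\<in>UNIV - S. p x = x)"
      using that permutes_superset by blast
    then obtain x where "x \<notin> S" "p x \<noteq> x" by blast
    then have "?N $ x $ p x = 0" by (simp add: axis_def)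
    then show ?thesis by (meson UNIV_I finite prod_zero)
  qed
  have on: "(\<Prod>i\<in>UNIV. ?N $ i $ p i) = (\<Prod>i\<in>S. M $ i $ p i)" if "p permutes S" for p
  proof -
    have "(\<Prod>i\<in>UNIV. ?N $ i $ p i) = (\<Prod>i\<in>S. ?N $ i $ p i)"
      by (rule prod.mono_neutral_right) (use permutes_not_in[OF that] in \<open>auto simp: axis_def\<close>)
    then show ?thesis by (simp add: row_def)
  qed
  have "det ?N = (\<Sum>p | p permutes S. of_int (sign p) * (\<Prod>i\<in>UNIV. ?N $ i $ p i))"
    unfolding det_def
    by (rule sum.mono_neutral_right)
       (use off permutes_subset[of _ S UNIV] in \<open>auto simp: finite_permutations\<close>)
  then show ?thesis
    using on by (simp add: principal_minor_def)
qed

lemma principal_minor_zero_row: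
  assumes "i \<in> S" "row i M = 0"
  shows "principal_minor M S = 0"
  unfolding principal_minor_eq_det
  by (rule det_zero_row(1)[of i]) (use assms in \<open>simp add: row_def vec_eq_iff\<close>)

lemma principal_minor_cong:
  assumes "\<And>i j. i \<in> S \<Longrightarrow> j \<in> S \<Longrightarrow> M $ i $ j = M' $ i $ j"
  shows "principal_minor M S = principal_minor M' S"
proof -
  have "(\<Prod>i\<in>S. M $ i $ p i) = (\<Prod>i\<in>S. M' $ i $ p i)" if p: "p permutes S" for p
    by (rule prod.cong) (auto simp: assms permutes_in_image[OF p])
  then show ?thesis
    unfolding principal_minor_def by (intro sum.cong refl) simp
qed

text \<open>Cramer's rule in row form, applied to the identity matrix.\<close>

lemma det_replace_row:
  "det ((\<chi> j. if j = i then x else axis j 1) :: real^'n^'n) = x $ i"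
proof -
  have "row j (mat 1 :: real^'n^'n) = axis j 1" for j
    by (auto simp: row_def mat_def axis_def vec_eq_iff)
  then show ?thesis
    using cramer_lemma_transpose[of i x "mat 1"] by (simp add: basis_expansion cong: if_cong)
qed

text \<open>Laplace expansion along column \<open>i\<close>; the cofactor is kept at full size by a
  unit row, so the index type does not change.\<close>

lemma det_column_single_entry:
  fixes M :: "real^'n^'n"
  assumes "\<And>j. j \<noteq> i \<Longrightarrow> M $ j $ i = 0"
  shows "det M = M $ i $ i * det (\<chi> j. if j = i then axis i 1 else row j M)"
    (is "_ = _ * det ?N")
proof -
  have "(\<Prod>j\<in>UNIV. M $ j $ p j) = M $ i $ i * (\<Prod>j\<in>UNIV. ?N $ j $ p j)"
    if p: "p permutes UNIV" for p
  proof (cases "p i = i")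
    case True
    have "(\<Prod>j\<in>UNIV. A $ j $ p j) = A $ i $ i * (\<Prod>j\<in>-{i}. A $ j $ p j)" for A :: "real^'n^'n"
      using True by (subst prod.remove[of _ i]) (simp_all add: Compl_eq_Diff_UNIV)
    moreover have "(\<Prod>j\<in>-{i}. ?N $ j $ p j) = (\<Prod>j\<in>-{i}. M $ j $ p j)"
      by (rule prod.cong) (auto simp: row_def)
    moreover have "?N $ i $ i = 1" by simp
    ultimately show ?thesis by (simp only: mult_1)
  next
    case False
    \<comment> \<open>The factor of row \<open>k\<close> lies in column \<open>i\<close> off the
      diagonal, so it is zero in both products.\<close>
    obtain k where k: "p k = i" using p by (metis permutes_surj surjD)
    then have "k \<noteq> i" using False by auto
    then have "M $ k $ p k = 0" "?N $ k $ p k = 0"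
      using k assms by (auto simp: row_def)
    then have "(\<Prod>j\<in>UNIV. M $ j $ p j) = 0" "(\<Prod>j\<in>UNIV. ?N $ j $ p j) = 0"
      using prod_zero[OF finite, of UNIV "\<lambda>j. M $ j $ p j"]
        prod_zero[OF finite, of UNIV "\<lambda>j. ?N $ j $ p j"] by blast+
    then show ?thesis by (simp only: mult_zero_right)
  qed
  then show ?thesis
    unfolding det_def sum_distrib_left by (intro sum.cong refl) (simp add: mult_ac)
qed

text \<open>This is the Schur complement step. Since row \<open>i\<close> of \<open>Q\<close> is
  zero, row \<open>i\<close> of the sum is \<open>w $ i *s w\<close>, and subtracting multiples of
  it removes the rank-one term from all other rows in \<open>S\<close>. Column \<open>i\<close> of
  \<open>Q\<close> being zero, a single entry then remains in column \<open>i\<close>.\<close>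

lemma principal_minor_add_rank_one:
  assumes i: "i \<in> S" and wi: "w $ i \<noteq> 0"
    and row: "\<And>j. Q $ i $ j = 0" and col: "\<And>j. Q $ j $ i = 0"
  shows "principal_minor (\<chi> j k. Q $ j $ k + w $ j * w $ k) S =
    (w $ i)\<^sup>2 * principal_minor Q (S - {i})"
proof -
  let ?M = "\<chi> j. if j \<in> S then row j (\<chi> j k. Q $ j $ k + w $ j * w $ k) else axis j 1"
  \<comment> \<open>Elimination multipliers: row \<open>j\<close> carries \<open>w $ j *s w\<close>
    and row \<open>i\<close> is \<open>w $ i *s w\<close>. Left multiplication by \<open>?E\<close>
    performs all these row operations at once.\<close>
  let ?c = "\<lambda>j. if j \<in> S \<and> j \<noteq> i then w $ j / w $ i else 0"
  let ?E = "(\<chi> j k. (if j = k then 1 else 0) - (if k = i then ?c j else 0)) :: real^'a^'a"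
  let ?R = "(\<chi> j. if j = i then w $ i *s w else if j \<in> S then row j Q else axis j 1) :: real^'a^'a"
  \<comment> \<open>\<open>?E\<close> differs from the identity in column \<open>i\<close> only,
    whereas \<open>det_replace_row\<close> speaks of a row.\<close>
  have "transpose ?E = (\<chi> j. if j = i then (\<chi> k. (if k = i then 1 else 0) - ?c k) else axis j 1)"
    by (auto simp: transpose_def vec_eq_iff axis_def)
  then have "det (transpose ?E) = 1"
    by (simp add: det_replace_row)
  then have detE: "det ?E = 1" by simp
  have EM: "?E ** ?M = ?R"
  proof -
    have "(?E ** ?M) $ j $ k = ?M $ j $ k - ?c j * ?M $ i $ k" for j k
    proof -
      have "(?E ** ?M) $ j $ k =
          (\<Sum>l\<in>UNIV. (if j = l then ?M $ l $ k else 0) - (if l = i then ?c j * ?M $ l $ k else 0))"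
        unfolding matrix_matrix_mult_def
        by (simp only: vec_lambda_beta) (intro sum.cong refl, simp add: left_diff_distrib)
      then show ?thesis by (simp add: sum_subtractf)
    qed
    then show ?thesis
      using i wi row by (auto simp: vec_eq_iff row_def)
  qed
  have "det ?M = det ?R"
    unfolding EM[symmetric] det_mul detE by simp
  also have "det ?R = ?R $ i $ i * det (\<chi> j. if j = i then axis i 1 else row j ?R)"
    by (rule det_column_single_entry) (use col in \<open>auto simp: row_def axis_def\<close>)
  also have "(\<chi> j. if j = i then axis i 1 else row j ?R) =
      (\<chi> j. if j \<in> S - {i} then row j Q else axis j 1)"
    by (auto simp: vec_eq_iff row_def)
  finally show ?thesis
    by (simp add: principal_minor_eq_det power2_eq_square)
qed

text \<open>The induction keeps \<open>c\<close> arbitrary: once row \<open>z\<close> is split by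
  linearity, its chosen summand is moved into \<open>c\<close>.\<close>

lemma det_rows_add:
  fixes a b c :: "'n::finite \<Rightarrow> real^'n"
  shows "det (\<chi> i. if i \<in> T then a i + b i else c i) =
    (\<Sum>S\<in>Pow T. det (\<chi> i. if i \<in> S then a i else if i \<in> T then b i else c i))"
proof (induction T arbitrary: c rule: finite_induct[OF finite])
  case 1
  show ?case by simp
next
  case (2 z T)
  have split: "(\<Sum>S\<in>Pow (insert z T). g S) = (\<Sum>S\<in>Pow T. g (insert z S)) + (\<Sum>S\<in>Pow T. g S)"
    for g :: "'n set \<Rightarrow> real"
  proof -
    have "inj_on (insert z) (Pow T)"
      using 2(2) by (auto intro!: inj_onI)
    moreover have "Pow T \<inter> insert z ` Pow T = {}"
      using 2(2) by auto
    ultimately show ?thesis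
      by (simp add: Pow_insert sum.union_disjoint sum.reindex add.commute)
  qed
  have "(\<chi> i. if i \<in> insert z T then a i + b i else c i) =
      (\<chi> i. if i = z then a i + b i else if i \<in> T then a i + b i else c i)"
    by (auto simp: vec_eq_iff)
  also have "det \<dots> = det (\<chi> i. if i = z then a i else if i \<in> T then a i + b i else c i)
      + det (\<chi> i. if i = z then b i else if i \<in> T then a i + b i else c i)"
    by (rule det_row_add)
  also have "(\<chi> i. if i = z then a i else if i \<in> T then a i + b i else c i) =
      (\<chi> i. if i \<in> T then a i + b i else if i = z then a i else c i)"
    using 2(2) by (auto simp: vec_eq_iff)
  also have "(\<chi> i. if i = z then b i else if i \<in> T then a i + b i else c i) =
      (\<chi> i. if i \<in> T then a i + b i else if i = z then b i else c i)"
    using 2(2) by (auto simp: vec_eq_iff)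
  also have "det (\<chi> i. if i \<in> T then a i + b i else if i = z then a i else c i) =
      (\<Sum>S\<in>Pow T. det (\<chi> i. if i \<in> insert z S then a i else if i \<in> insert z T then b i else c i))"
    unfolding 2(3) by (intro sum.cong refl arg_cong[where f=det]) (auto simp: vec_eq_iff 2(2))
  also have "det (\<chi> i. if i \<in> T then a i + b i else if i = z then b i else c i) =
      (\<Sum>S\<in>Pow T. det (\<chi> i. if i \<in> S then a i else if i \<in> insert z T then b i else c i))"
    unfolding 2(3) by (intro sum.cong refl arg_cong[where f=det]) (use 2(2) in \<open>auto simp: vec_eq_iff\<close>)
  finally show ?case
    unfolding split .
qed

text \<open>Choosing in every row either the part from \<open>M\<close> or the unit row from
  \<open>mat 1\<close> produces exactly the padded minors.\<close>

lemma det_add_mat_1: "det (M + mat 1) = (\<Sum>S\<in>UNIV. principal_minor M S)"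
proof -
  have "M + mat 1 = (\<chi> i. if i \<in> UNIV then row i M + axis i 1 else 0)"
    by (auto simp: vec_eq_iff row_def mat_def axis_def)
  then have "det (M + mat 1) =
      (\<Sum>S\<in>Pow UNIV. det (\<chi> i. if i \<in> S then row i M else if i \<in> UNIV then axis i 1 else 0))"
    by (simp only: det_rows_add)
  then show ?thesis
    by (simp add: principal_minor_eq_det cong: if_cong)
qed

text \<open>Zeroing row \<open>i\<close> of \<open>L\<close> kills exactly the minors containing
  \<open>i\<close>. The assumption on \<open>K\<close> makes this change of \<open>L + mat 1\<close>
  a left multiplication by a matrix of determinant \<open>1 - K $ i $ i\<close>.\<close>

lemma sum_principal_minor_not_containing:
  assumes "K ** (L + mat 1) = L"
  shows "(\<Sum>Y | i \<notin> Y. principal_minor L Y) = (1 - K $ i $ i) * det (L + mat 1)"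
proof -
  let ?L = "(\<chi> j. if j = i then 0 else row j L) :: real^'a^'a"
  \<comment> \<open>Row \<open>i\<close> of \<open>K ** (L + mat 1)\<close> is row \<open>i\<close>
    of \<open>L\<close>; subtracting it from row \<open>i\<close> of \<open>L + mat 1\<close> leaves
    the unit row \<open>axis i 1\<close>.\<close>
  let ?E = "(\<chi> j. if j = i then axis i 1 - row i K else axis j 1) :: real^'a^'a"
  have E: "?E ** (L + mat 1) = ?L + mat 1"
  proof -
    have "(?E ** (L + mat 1)) $ j $ k = (?L + mat 1) $ j $ k" for j k
    proof (cases "j = i")
      case True
      have "(?E ** (L + mat 1)) $ j $ k = (mat 1 ** (L + mat 1)) $ i $ k - (K ** (L + mat 1)) $ i $ k"
        using True by (simp add: matrix_matrix_mult_def mat_def axis_def row_def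
            left_diff_distrib sum_subtractf eq_commute[of i])
      then show ?thesis
        using True assms by simp
    next
      case False
      have "(?E ** (L + mat 1)) $ j $ k = (mat 1 ** (L + mat 1)) $ j $ k"
        unfolding matrix_matrix_mult_def using False by (simp add: mat_def axis_def eq_commute[of j])
      then show ?thesis
        using False by (simp add: row_def)
    qed
    then show ?thesis by (simp add: vec_eq_iff)
  qed
  have "(1 - K $ i $ i) * det (L + mat 1) = det (?L + mat 1)"
    unfolding E[symmetric] det_mul det_replace_row by (simp add: row_def)
  also have "\<dots> = (\<Sum>Y\<in>UNIV. principal_minor ?L Y)"
    by (rule det_add_mat_1)
  also have "\<dots> = (\<Sum>Y | i \<notin> Y. principal_minor ?L Y)"
    by (rule sum.mono_neutral_right) (auto intro!: principal_minor_zero_row simp: row_def vec_eq_iff)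
  also have "\<dots> = (\<Sum>Y | i \<notin> Y. principal_minor L Y)"
    by (intro sum.cong refl principal_minor_cong) (auto simp: row_def)
  finally show ?thesis ..
qed

section \<open>Expansion of minors over the modes\<close>

lemma mult_diag_matrix: "(V ** diag_matrix w) $ i $ j = V $ i $ j * w j"
proof -
  have "(V ** diag_matrix w) $ i $ j = (\<Sum>k\<in>UNIV. if k = j then V $ i $ k * w k else 0)"
    unfolding matrix_matrix_mult_def diag_matrix_def
    by (simp only: vec_lambda_beta) (rule sum.cong, auto)
  then show ?thesis by simp
qed

text \<open>Terms with non-injective f have two proportional rows and vanish.\<close>

lemma principal_minor_spectral:
  fixes V :: "real^'n^'n"
  shows "principal_minor (V ** diag_matrix w ** transpose V) Y =
    (\<Sum>f | (\<forall>i. i \<notin> Y \<longrightarrow> f i = i) \<and> inj_on f Y.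
      (\<Prod>i\<in>Y. w (f i)) *
      det (\<chi> i. if i \<in> Y then V $ i $ f i *s column (f i) V else axis i 1))"
proof -
  \<comment> \<open>Keeping \<open>w j\<close> as the outermost scalar lets the weights leave the
    determinant as one product.\<close>
  have entry: "row i (V ** diag_matrix w ** transpose V) =
      (\<Sum>j\<in>UNIV. w j *s (V $ i $ j *s column j V))" for i
  proof -
    show ?thesis
      by (simp add: vec_eq_iff row_def matrix_matrix_mult_def[of "V ** diag_matrix w"]
          mult_diag_matrix transpose_def column_def mult_ac)
  qed
  let ?G = "\<lambda>f. det (\<chi> i. if i \<in> Y then V $ i $ f i *s column (f i) V else axis i 1)"
  have scale: "det (\<chi> i. if i \<in> Y then w (f i) *s (V $ i $ f i *s column (f i) V) else axis i 1) =
      (\<Prod>i\<in>Y. w (f i)) * ?G f" for f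
  proof -
    have "(\<chi> i. if i \<in> Y then w (f i) *s (V $ i $ f i *s column (f i) V) else axis i 1) =
       (\<chi> i. (if i \<in> Y then w (f i) else 1) *s
          (if i \<in> Y then V $ i $ f i *s column (f i) V else axis i 1))"
      by (auto simp: vec_eq_iff)
    moreover have "(\<Prod>i\<in>UNIV. if i \<in> Y then w (f i) else 1) = (\<Prod>i\<in>Y. w (f i))"
      by (simp add: prod.If_cases)
    ultimately show ?thesis by (simp add: det_rows_mul)
  qed
  have vanish: "?G f = 0" if not_inj: "\<not> inj_on f Y" for f
  proof -
    obtain i j where ij: "i \<in> Y" "j \<in> Y" "i \<noteq> j" "f i = f j"
      using not_inj unfolding inj_on_def by blast
    let ?c = "\<lambda>k. if k \<in> Y then V $ k $ f k else 1"
    let ?a = "\<lambda>k. if k \<in> Y then column (f k) V else axis k 1"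
    have "(\<chi> k. if k \<in> Y then V $ k $ f k *s column (f k) V else axis k 1) = (\<chi> k. ?c k *s ?a k)"
      by (auto simp: vec_eq_iff)
    moreover have "det (\<chi> k. ?a k) = 0"
      using ij by (intro det_identical_rows[of i j]) (auto simp: row_def)
    ultimately show ?thesis by (simp add: det_rows_mul)
  qed
  \<comment> \<open>Multilinearity picks a mode \<open>f i\<close> for each row in \<open>Y\<close>;
    fixing \<open>f\<close> as the identity off \<open>Y\<close> counts each choice once.\<close>
  have "principal_minor (V ** diag_matrix w ** transpose V) Y =
      (\<Sum>f | (\<forall>i\<in>Y. f i \<in> UNIV) \<and> (\<forall>i. i \<notin> Y \<longrightarrow> f i = i).
        det (\<chi> i. if i \<in> Y then w (f i) *s (V $ i $ f i *s column (f i) V) else axis i 1))"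
    unfolding principal_minor_eq_det entry
    by (rule det_linear_rows_sum_lemma) auto
  also have "\<dots> = (\<Sum>f | \<forall>i. i \<notin> Y \<longrightarrow> f i = i. (\<Prod>i\<in>Y. w (f i)) * ?G f)"
    by (simp add: scale)
  also have "\<dots> = (\<Sum>f | (\<forall>i. i \<notin> Y \<longrightarrow> f i = i) \<and> inj_on f Y. (\<Prod>i\<in>Y. w (f i)) * ?G f)"
    by (rule sum.mono_neutral_right) (use vanish in auto)
  finally show ?thesis .
qed

section \<open>Orthonormal sets and their projections\<close>

text \<open>For orthonormal \<open>B\<close> this sum of outer products is the matrix of the
  orthogonal projection to \<open>span B\<close>.\<close>

definition span_projection :: "(real^'n) set \<Rightarrow> real^'n^'n" where
  "span_projection B = (\<chi> i j. \<Sum>v\<in>B. v $ i * v $ j)"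

lemma orthonormal_inner:
  assumes "orthonormal B" "u \<in> B" "v \<in> B"
  shows "u \<bullet> v = (if u = v then 1 else 0)"
  using assms by (auto simp: orthonormal_def pairwise_def orthogonal_def norm_eq_1)

text \<open>The vectors fixed by the projection form a subspace containing \<open>B\<close>.\<close>

lemma orthonormal_expansion:
  assumes "orthonormal B" "x \<in> span B"
  shows "(\<Sum>v\<in>B. (v \<bullet> x) *\<^sub>R v) = x"
proof (rule span_induct[OF assms(2)])
  fix x assume x: "x \<in> B"
  then have "(\<Sum>v\<in>B. (v \<bullet> x) *\<^sub>R v) = (\<Sum>v\<in>B. if v = x then x else 0)"
    by (intro sum.cong refl) (auto simp: orthonormal_inner[OF assms(1)])
  also have "\<dots> = x"
    using x orthonormal_imp_finite[OF assms(1)] by simp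
  finally show "(\<Sum>v\<in>B. (v \<bullet> x) *\<^sub>R v) = x" .
next
  show "subspace {x. (\<Sum>v\<in>B. (v \<bullet> x) *\<^sub>R v) = x}"
    by (auto simp: subspace_def inner_add_right scaleR_add_left sum.distrib scaleR_scaleR[symmetric]
        simp del: scaleR_scaleR simp flip: scaleR_sum_right)
qed

text \<open>Allows \<open>B\<close> to be exchanged for a basis adapted to the drawn node. Expanding
  the vectors of \<open>B\<close> in \<open>B'\<close> and swapping the sums leaves the expansions
  of the vectors of \<open>B'\<close> in \<open>B\<close>.\<close>

lemma span_projection_cong:
  fixes B B' :: "(real^'n) set"
  assumes B: "orthonormal B" and B': "orthonormal B'" and eq: "span B = span B'"
  shows "span_projection B = span_projection B'"
proof -
  have comp: "x $ j = (\<Sum>v\<in>C. (v \<bullet> x) * v $ j)" if "orthonormal C" "x \<in> span C"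
    for x :: "real^'n" and C j
    using arg_cong[OF orthonormal_expansion[OF that], of "\<lambda>y. y $ j"] by (simp add: sum_component)
  have "(\<Sum>v\<in>B. v $ i * v $ j) = (\<Sum>u\<in>B'. u $ i * u $ j)" for i j
  proof -
    have "(\<Sum>v\<in>B. v $ i * v $ j) = (\<Sum>v\<in>B. v $ i * (\<Sum>u\<in>B'. (u \<bullet> v) * u $ j))"
      by (intro sum.cong refl arg_cong2[where f="(*)"] comp[OF B']) (metis eq span_base)
    also have "\<dots> = (\<Sum>u\<in>B'. (\<Sum>v\<in>B. (v \<bullet> u) * v $ i) * u $ j)"
      unfolding sum_distrib_left sum_distrib_right
      by (subst sum.swap) (simp add: mult_ac inner_commute)
    also have "\<dots> = (\<Sum>u\<in>B'. u $ i * u $ j)"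
      by (intro sum.cong refl arg_cong2[where f="(*)"] comp[OF B, symmetric]) (metis eq span_base)
    finally show ?thesis .
  qed
  then show ?thesis by (simp add: span_projection_def)
qed

lemma orthonormal_card_eq_dim:
  assumes "orthonormal B" shows "card B = dim (span B)"
proof -
  have "independent B"
    using assms by (intro pairwise_orthogonal_independent) (auto simp: orthonormal_def)
  then show ?thesis by (simp add: dim_span dim_eq_card_independent)
qed

lemma perp_basis_entry:
  assumes "v \<in> perp_basis B i" shows "v $ i = 0"
proof -
  have "v \<in> span (perp_basis B i)" using assms by (rule span_base)
  then show ?thesis by (simp add: perp_basis orthogonal_def inner_axis)
qed

text \<open>The vector w is the normalized projection of the i-th standard basis vector to the span of B.
  It extends the new basis to an orthonormal basis of the span of B.\<close>

lemma perp_basis_decomposition: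
  fixes B :: "(real^'n) set"
  assumes B: "orthonormal B" and p: "(\<Sum>v\<in>B. (v $ i)\<^sup>2) \<noteq> 0"
  obtains w where "(w $ i)\<^sup>2 = (\<Sum>v\<in>B. (v $ i)\<^sup>2)"
    "card B = Suc (card (perp_basis B i))"
    "span_projection B = (\<chi> j k. span_projection (perp_basis B i) $ j $ k + w $ j * w $ k)"
proof -
  let ?p = "\<Sum>v\<in>B. (v $ i)\<^sup>2" and ?B' = "perp_basis B i"
  define u where "u = (\<Sum>v\<in>B. v $ i *\<^sub>R v)"
  define w where "w = (1 / sqrt ?p) *\<^sub>R u"
  have pos: "?p > 0" using p by (simp add: less_le sum_nonneg)
  have ui: "u $ i = ?p" by (simp add: u_def sum_component power2_eq_square)
  \<comment> \<open>On \<open>span B\<close>, \<open>u\<close> represents the i-th coordinate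
    functional; this gives both the norm of \<open>u\<close> and its orthogonality to the new
    basis.\<close>
  have inner_u: "x \<bullet> u = x $ i" if "x \<in> span B" for x
  proof -
    have "x \<bullet> u = (\<Sum>v\<in>B. (v \<bullet> x) *\<^sub>R v) $ i"
      by (simp add: u_def inner_sum_right sum_component mult.commute inner_commute)
    then show ?thesis using orthonormal_expansion[OF B that] by simp
  qed
  have u: "u \<in> span B" unfolding u_def by (intro span_sum span_scale span_base)
  then have w: "w \<in> span B" by (simp add: w_def span_scale)
  have wi: "w $ i = sqrt ?p"
    using pos by (simp add: w_def ui real_div_sqrt)
  have norm_w: "norm w = 1"
    using inner_u[OF u] pos by (simp add: w_def norm_eq_sqrt_inner ui real_sqrt_mult)
  have sub: "x \<in> span B" "x $ i = 0" if "x \<in> ?B'" for x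
    using that span_base[of x ?B'] by (auto simp: perp_basis(2) perp_basis_entry)
  have orth: "orthogonal w x" if "x \<in> ?B'" for x
    using inner_u[OF sub(1)[OF that]] sub(2)[OF that] by (simp add: w_def orthogonal_def inner_commute)
  have wnot: "w \<notin> ?B'" using wi pos sub(2) by fastforce
  have ON: "orthonormal (insert w ?B')"
    using perp_basis(1)[of B i] norm_w orth
    by (auto simp: orthonormal_def pairwise_insert orthogonal_commute)
  have span: "span (insert w ?B') = span B"
  proof
    show "span (insert w ?B') \<subseteq> span B"
      using w sub(1) by (intro span_minimal) auto
    show "span B \<subseteq> span (insert w ?B')"
    proof
      fix x assume x: "x \<in> span B"
      \<comment> \<open>The multiple of \<open>w\<close> is chosen to cancel the i-th coordinate, so
        the rest lies in the span of the new basis.\<close>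
      let ?y = "x - (x $ i / w $ i) *\<^sub>R w"
      have "?y \<in> span B" using x w by (intro span_diff span_scale)
      moreover have "?y $ i = 0" using wi pos by simp
      ultimately have "?y \<in> span ?B'"
        by (simp add: perp_basis(2) orthogonal_def inner_axis)
      then have "?y + (x $ i / w $ i) *\<^sub>R w \<in> span (insert w ?B')"
        by (intro span_add span_scale) (auto intro: span_base span_mono[THEN subsetD, of ?B'])
      then show "x \<in> span (insert w ?B')" by simp
    qed
  qed
  have fin: "finite ?B'" by (rule orthonormal_imp_finite[OF perp_basis(1)])
  show thesis
  proof
    show "(w $ i)\<^sup>2 = ?p" using wi pos by simp
    have "card (insert w ?B') = card B"
      using orthonormal_card_eq_dim[OF ON] orthonormal_card_eq_dim[OF B] span by simp
    then show "card B = Suc (card ?B')" using wnot fin by simp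
    show "span_projection B = (\<chi> j k. span_projection ?B' $ j $ k + w $ j * w $ k)"
      unfolding span_projection_cong[OF B ON span[symmetric]]
      using wnot fin by (simp add: span_projection_def vec_eq_iff)
  qed
qed

section \<open>Law of the node sampling phase\<close>

text \<open>The nodes collected so far never influence the draws, so the later rounds may be
  analysed as a run starting from the empty set.\<close>

lemma sample_nodes_Un:
  "sample_nodes k B (Z \<union> Z') = map_pmf ((\<union>) Z) (sample_nodes k B Z')"
proof (induction k arbitrary: B Z')
  case 0
  show ?case by simp
next
  case (Suc k)
  have "insert i (Z \<union> Z') = Z \<union> insert i Z'" for i by auto
  then show ?case by (simp add: map_bind_pmf Suc del: Un_insert_right)
qed

text \<open>The bound on \<open>card B\<close> ensures that the loop is not cut short. Conditioning
  on the first node, each of the \<open>card B\<close> nodes of \<open>Y\<close> contributes the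
  same share of the minor.\<close>

theorem pmf_sample_nodes:
  fixes B :: "(real^'n) set"
  assumes "orthonormal B" "card B \<le> k"
  shows "pmf (sample_nodes k B {}) Y =
    (if card Y = card B then principal_minor (span_projection B) Y else 0)"
  using assms
proof (induction k arbitrary: B Y)
  case 0
  then show ?case
    using orthonormal_imp_finite[of B]
    by (auto simp: principal_minor_empty card_eq_0_iff)
next
  case (Suc k)
  note fin = orthonormal_imp_finite[OF Suc.prems(1)]
  let ?M = "principal_minor (span_projection B)" and ?p = "\<lambda>i. \<Sum>v\<in>B. (v $ i)\<^sup>2"
  show ?case
  proof (cases "B = {}")
    case True
    then show ?thesis by (auto simp: principal_minor_empty card_eq_0_iff)
  next
    case False
    have c: "card B > 0" using False fin by (simp add: card_gt_0_iff)
    \<comment> \<open>The factor \<open>?p i\<close> of the drawing probability is the one that the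
      Schur complement splits off the minor.\<close>
    have step: "pmf (sample_nodes k (perp_basis B i) {i}) Y * (?p i / card B) =
        (if i \<in> Y \<and> card Y = card B then ?M Y / card B else 0)" for i
    proof (cases "?p i = 0")
      case True
      \<comment> \<open>Here \<open>i\<close> is never drawn; the right side vanishes too, because
        row \<open>i\<close> of the projection is zero.\<close>
      then have "v $ i = 0" if "v \<in> B" for v
        using that fin by (simp add: sum_nonneg_eq_0_iff)
      then have "row i (span_projection B) = 0"
        by (simp add: span_projection_def row_def vec_eq_iff)
      then have "i \<in> Y \<Longrightarrow> ?M Y = 0"
        using principal_minor_zero_row by blast
      then show ?thesis using True by simp
    next
      case nz: False
      let ?B' = "perp_basis B i"
      let ?q = "sample_nodes k ?B' {}"
      obtain w where w: "(w $ i)\<^sup>2 = ?p i" and card: "card B = Suc (card ?B')"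
        and proj: "span_projection B = (\<chi> j k. span_projection ?B' $ j $ k + w $ j * w $ k)"
        using perp_basis_decomposition[OF Suc.prems(1) nz] .
      have zero: "span_projection ?B' $ i $ j = 0" "span_projection ?B' $ j $ i = 0" for j
        by (simp_all add: span_projection_def perp_basis_entry)
      then have row: "row i (span_projection ?B') = 0"
        by (simp add: row_def vec_eq_iff)
      have IH: "pmf ?q Y' =
          (if card Y' = card ?B' then principal_minor (span_projection ?B') Y' else 0)" for Y'
        by (rule Suc.IH) (use Suc.prems(2) card in \<open>auto simp: perp_basis\<close>)
      \<comment> \<open>A drawn node does not recur, so among the preimages of \<open>Y\<close>
        under \<open>insert i\<close> only \<open>Y - {i}\<close> has mass.\<close>
      have q0: "pmf ?q Y' = 0" if "i \<in> Y'" for Y'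
        using principal_minor_zero_row[OF that row] by (simp add: IH)
      have "(\<union>) {i} = insert i" by auto
      then have "pmf (sample_nodes k ?B' {i}) Y = measure ?q (insert i -` {Y})"
        using sample_nodes_Un[of k ?B' "{i}" "{}"] by (simp add: pmf_map)
      also have "\<dots> = (\<Sum>Y'\<in>insert i -` {Y}. pmf ?q Y')"
        by (rule measure_measure_pmf_finite) simp
      also have "\<dots> = (\<Sum>Y'\<in>(if i \<in> Y then {Y - {i}} else {}). pmf ?q Y')"
        by (rule sum.mono_neutral_right) (auto intro!: q0)
      finally have *: "pmf (sample_nodes k ?B' {i}) Y = (if i \<in> Y then pmf ?q (Y - {i}) else 0)"
        by simp
      show ?thesis
      proof (cases "i \<in> Y")
        case True
        have "w $ i \<noteq> 0" using w nz by auto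
        then have "?M Y = ?p i * principal_minor (span_projection ?B') (Y - {i})"
          unfolding proj w[symmetric]
          by (rule principal_minor_add_rank_one[OF True]) (rule zero)+
        moreover have "card Y = card B \<longleftrightarrow> card (Y - {i}) = card ?B'"
          using True card card_Suc_Diff1[of Y i] by auto
        ultimately show ?thesis using True by (simp add: * IH)
      qed (simp add: *)
    qed
    have "pmf (sample_nodes (Suc k) B {}) Y =
        (\<Sum>i\<in>UNIV. pmf (sample_nodes k (perp_basis B i) {i}) Y * pmf (pick_node B) i)"
      using False by (simp add: pmf_bind integral_measure_pmf_real[of UNIV])
    also have "\<dots> = (\<Sum>i\<in>UNIV. if i \<in> Y \<and> card Y = card B then ?M Y / card B else 0)"
      by (simp only: pmf_pick_node[OF Suc.prems(1) False] step)
    also have "\<dots> = (\<Sum>i\<in>Y. if card Y = card B then ?M Y / card B else 0)"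
      by (rule sum.mono_neutral_cong_right) auto
    also have "\<dots> = (if card Y = card B then ?M Y else 0)"
      using c by simp
    finally show ?thesis .
  qed
qed

section \<open>Matrices diagonalised by an orthogonal matrix\<close>

lemma conjugate_diag_matrix_mult:
  assumes "orthogonal_matrix V"
  shows "(V ** diag_matrix a ** transpose V) ** (V ** diag_matrix b ** transpose V) =
    V ** diag_matrix (\<lambda>i. a i * b i) ** transpose V"
proof -
  have "diag_matrix a ** diag_matrix b = diag_matrix (\<lambda>i. a i * b i)"
    by (auto simp: vec_eq_iff mult_diag_matrix) (simp_all add: diag_matrix_def)
  moreover have "transpose V ** V = mat 1"
    using assms by (simp add: orthogonal_matrix)
  then have "transpose V ** (V ** X) = X" for X :: "real^'a^'a"
    by (simp add: matrix_mul_assoc)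
  then have "(V ** diag_matrix a ** transpose V) ** (V ** diag_matrix b ** transpose V) =
      V ** (diag_matrix a ** diag_matrix b) ** transpose V"
    by (simp only: matrix_mul_assoc[symmetric])
  ultimately show ?thesis by simp
qed

lemma conjugate_diag_matrix_add_mat_1:
  assumes "orthogonal_matrix V"
  shows "V ** diag_matrix a ** transpose V + mat 1 = V ** diag_matrix (\<lambda>i. a i + 1) ** transpose V"
proof -
  have "V ** diag_matrix (\<lambda>i. a i + 1) = V ** diag_matrix a + V"
    by (simp add: vec_eq_iff mult_diag_matrix distrib_left)
  moreover have "(X + Y) ** Z = X ** Z + Y ** Z" for X Y Z :: "real^'a^'a"
    by (simp add: vec_eq_iff matrix_matrix_mult_def distrib_right sum.distrib)
  ultimately show ?thesis
    using assms by (simp add: orthogonal_matrix_def)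
qed

lemma conjugate_diag_matrix_one:
  assumes "orthogonal_matrix V" "\<And>i. a i = 1"
  shows "V ** diag_matrix a ** transpose V = mat 1"
proof -
  have "diag_matrix a = mat 1"
    by (simp add: diag_matrix_def mat_def assms(2) cong: if_cong)
  then show ?thesis using assms(1) by (simp add: orthogonal_matrix_def)
qed

lemma det_conjugate_diag_matrix:
  assumes "orthogonal_matrix V"
  shows "det (V ** diag_matrix a ** transpose V) = (\<Prod>i\<in>UNIV. a i)"
proof -
  have "det V * det V = 1"
    using det_orthogonal_matrix[OF assms] by auto
  moreover have "det (diag_matrix a) = (\<Prod>i\<in>UNIV. a i)"
    by (subst det_diagonal) (auto simp: diag_matrix_def)
  ultimately show ?thesis by (simp add: det_mul)
qed

lemma trace_conjugate_diag_matrix: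
  assumes "orthogonal_matrix V"
  shows "trace (V ** diag_matrix a ** transpose V) = (\<Sum>i\<in>UNIV. a i)"
proof -
  have "trace (V ** diag_matrix a ** transpose V) = trace (transpose V ** (V ** diag_matrix a))"
    by (rule trace_mul_sym)
  also have "transpose V ** (V ** diag_matrix a) = diag_matrix a"
    using assms by (simp add: matrix_mul_assoc orthogonal_matrix)
  finally show ?thesis by (simp add: trace_def diag_matrix_def)
qed

lemma conjugate_diag_matrix_mult_column:
  assumes "orthogonal_matrix V"
  shows "(V ** diag_matrix a ** transpose V) *v column i V = a i *s column i V"
proof -
  have "(V ** diag_matrix a ** transpose V) *v column i V =
      column i ((V ** diag_matrix a ** transpose V) ** V)"
    by (simp add: vec_eq_iff column_def matrix_vector_mult_def matrix_matrix_mult_def)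
  also have "(V ** diag_matrix a ** transpose V) ** V = V ** diag_matrix a"
    using assms by (simp add: orthogonal_matrix flip: matrix_mul_assoc)
  finally show ?thesis
    by (simp add: column_def mult_diag_matrix vec_eq_iff)
qed

lemma marginal_kernel_spectral:
  assumes V: "orthogonal_matrix V" and a: "\<And>i. a i \<noteq> - 1"
  shows "marginal_kernel (V ** diag_matrix a ** transpose V) =
    V ** diag_matrix (\<lambda>i. a i / (a i + 1)) ** transpose V"
proof -
  let ?S = "\<lambda>a. V ** diag_matrix a ** transpose V"
  have nz: "a i + 1 \<noteq> 0" for i using a[of i] by (simp add: add_eq_0_iff)
  have inv: "?S (\<lambda>i. 1 / (a i + 1)) ** ?S (\<lambda>i. a i + 1) = mat 1"
    unfolding conjugate_diag_matrix_mult[OF V] by (rule conjugate_diag_matrix_one[OF V]) (simp add: nz)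
  then have "invertible (?S (\<lambda>i. a i + 1))"
    using invertible_def matrix_left_right_inverse by blast
  \<comment> \<open>\<open>matrix_inv\<close> is a chosen inverse; multiplying its defining equation
    by the explicit left inverse identifies it.\<close>
  then have "?S (\<lambda>i. a i + 1) ** matrix_inv (?S (\<lambda>i. a i + 1)) = mat 1"
    unfolding invertible_def matrix_inv_def by (rule someI_ex[THEN conjunct1])
  then have "?S (\<lambda>i. 1 / (a i + 1)) ** (?S (\<lambda>i. a i + 1) ** matrix_inv (?S (\<lambda>i. a i + 1))) =
      ?S (\<lambda>i. 1 / (a i + 1))"
    by (simp only: matrix_mul_rid)
  then have "matrix_inv (?S (\<lambda>i. a i + 1)) = ?S (\<lambda>i. 1 / (a i + 1))"
    unfolding matrix_mul_assoc[of "?S _" "?S _"] inv matrix_mul_lid .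
  then show ?thesis
    unfolding marginal_kernel_def conjugate_diag_matrix_add_mat_1[OF V]
    by (simp add: conjugate_diag_matrix_mult[OF V])
qed

section \<open>Eigenvectors of a set of modes\<close>

lemma orthonormal_columns:
  assumes "orthogonal_matrix V"
  shows "orthonormal ((\<lambda>j. column j V) ` J)"
  using assms unfolding orthogonal_matrix_orthonormal_columns orthonormal_def
  by (auto intro!: pairwise_imageI)

lemma inj_columns:
  fixes V :: "real^'n^'n"
  assumes "orthogonal_matrix V"
  shows "inj (\<lambda>j. column j V)"
proof (rule injI, rule ccontr)
  fix i j assume "column i V = column j V" "i \<noteq> j"
  then have "column i V \<bullet> column i V = 0" "norm (column i V) = 1"
    using assms unfolding orthogonal_matrix_orthonormal_columns orthogonal_def by metis+
  then show False by simp
qed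

text \<open>Gives the projection for \<open>J\<close> the same form as \<open>L\<close>, with
  weights 0 and 1, so that one expansion of minors serves both.\<close>

lemma span_projection_columns:
  assumes "orthogonal_matrix V"
  shows "span_projection ((\<lambda>j. column j V) ` J) = V ** diag_matrix (indicator J) ** transpose V"
proof -
  have "(\<Sum>v\<in>(\<lambda>j. column j V) ` J. v $ i * v $ k) = (\<Sum>j\<in>UNIV. V $ i $ j * indicator J j * V $ k $ j)"
    for i k
    by (subst sum.reindex[OF inj_on_subset[OF inj_columns[OF assms] subset_UNIV]])
       (auto simp: column_def indicator_def intro!: sum.mono_neutral_cong_left)
  then show ?thesis
    by (simp add: span_projection_def vec_eq_iff matrix_matrix_mult_def[of "V ** diag_matrix _"]
        mult_diag_matrix transpose_def)
qed

section \<open>Law of the random set of modes\<close>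

lemma pmf_select_modes:
  assumes "\<And>i. 0 \<le> lam i"
  shows "pmf (select_modes lam) J = (\<Prod>i\<in>J. lam i) / (\<Prod>i\<in>UNIV. lam i + 1)"
proof -
  have pos: "lam i + 1 > 0" for i using assms[of i] by simp
  have "pmf (select_modes lam) J =
      pmf (Pi_pmf UNIV False (\<lambda>i. bernoulli_pmf (lam i / (lam i + 1)))) (\<lambda>i. i \<in> J)"
    unfolding select_modes_def
    by (subst pmf_map_inj'[of Collect, symmetric]) (auto simp: inj_def)
  also have "\<dots> = (\<Prod>i\<in>UNIV. (if i \<in> J then lam i else 1) / (lam i + 1))"
  proof (subst pmf_Pi')
    have "0 \<le> lam i / (lam i + 1)" "lam i / (lam i + 1) \<le> 1"
      "1 - lam i / (lam i + 1) = 1 / (lam i + 1)" for i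
      using assms[of i] pos[of i] by (simp_all add: divide_simps)
    then show "(\<Prod>i\<in>UNIV. pmf (bernoulli_pmf (lam i / (lam i + 1))) (i \<in> J)) =
        (\<Prod>i\<in>UNIV. (if i \<in> J then lam i else 1) / (lam i + 1))"
      by (intro prod.cong refl) simp
  qed simp_all
  also have "\<dots> = (\<Prod>i\<in>J. lam i) / (\<Prod>i\<in>UNIV. lam i + 1)"
    by (simp add: prod_dividef prod.If_cases)
  finally show ?thesis .
qed

text \<open>A product event constraining only the coins in \<open>F\<close>. Singletons give the
  marginals, pairs the second moment, and general \<open>F\<close> the independence.\<close>

lemma prob_select_modes_superset:
  assumes "\<And>i. 0 \<le> lam i"
  shows "measure_pmf.prob (select_modes lam) {J. F \<subseteq> J} = (\<Prod>i\<in>F. lam i / (lam i + 1))"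
proof -
  let ?P = "Pi_pmf UNIV False (\<lambda>i. bernoulli_pmf (lam i / (lam i + 1)))"
  have k: "0 \<le> lam i / (lam i + 1)" "lam i / (lam i + 1) \<le> 1" for i
    using assms[of i] by (auto simp: field_simps)
  have "measure_pmf.prob (select_modes lam) {J. F \<subseteq> J} =
      measure_pmf.prob ?P (PiE_dflt UNIV False (\<lambda>i. if i \<in> F then {True} else UNIV))"
    unfolding select_modes_def
    by (auto simp: PiE_dflt_def intro!: arg_cong2[where f=measure] split: if_splits)
  also have "\<dots> = (\<Prod>i\<in>UNIV. if i \<in> F then lam i / (lam i + 1) else 1)"
    by (subst measure_Pi_pmf_PiE_dflt)
       (auto intro!: prod.cong simp: measure_pmf_single pmf_bernoulli_True[OF k])
  finally show ?thesis by (simp add: prod.If_cases)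
qed

section \<open>Joint law of modes and nodes\<close>

lemma map_fst_spectral_sampler: "map_pmf fst (spectral_sampler V lam) = select_modes lam"
  by (simp add: spectral_sampler_def map_bind_pmf pmf.map_comp o_def map_pmf_const bind_return_pmf')

text \<open>The node phase puts mass only on sets as large as its orthonormal starting set; this
  reduces the size of \<open>Y\<close> to a count of independent coins.\<close>

lemma card_spectral_sampler:
  assumes V: "orthogonal_matrix V" and "(J, Y) \<in> set_pmf (spectral_sampler V lam)"
  shows "card Y = card J"
proof -
  let ?B = "(\<lambda>j. column j V) ` J"
  have card: "card ?B = card J"
    by (rule card_image[OF inj_on_subset[OF inj_columns[OF V] subset_UNIV]])
  have "Y \<in> set_pmf (sample_nodes CARD('a) ?B {})"
    using assms(2) by (auto simp: spectral_sampler_def)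
  then have "pmf (sample_nodes CARD('a) ?B {}) Y \<noteq> 0" by (simp add: set_pmf_iff)
  then show ?thesis
    using pmf_sample_nodes[OF orthonormal_columns[OF V], of J "CARD('a)" Y]
    by (simp add: card card_mono split: if_splits)
qed

theorem pmf_spectral_sampler_nodes:
  assumes V: "orthogonal_matrix V" and lam: "\<And>i. 0 \<le> lam i"
    and L: "L = V ** diag_matrix lam ** transpose V"
  shows "pmf (map_pmf snd (spectral_sampler V lam)) Y = principal_minor L Y / det (L + mat 1)"
proof -
  let ?B = "\<lambda>J. (\<lambda>j. column j V) ` J"
  let ?F = "{f. (\<forall>i. i \<notin> Y \<longrightarrow> f i = i) \<and> inj_on f Y}"
  let ?G = "\<lambda>f. det (\<chi> i. if i \<in> Y then V $ i $ f i *s column (f i) V else axis i 1)"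
  let ?D = "\<Prod>i\<in>UNIV. lam i + 1"
  have D: "det (L + mat 1) = ?D"
    unfolding L conjugate_diag_matrix_add_mat_1[OF V] by (rule det_conjugate_diag_matrix[OF V])
  have card: "card (?B J) = card J" for J
    by (rule card_image[OF inj_on_subset[OF inj_columns[OF V] subset_UNIV]])
  \<comment> \<open>With indicator weights a term survives only if \<open>f\<close> maps
    \<open>Y\<close> into \<open>J\<close>; for injective \<open>f\<close> and equal cardinalities
    this forces \<open>J = f\<close> applied to \<open>Y\<close>, so each \<open>f\<close> selects
    one \<open>J\<close>.\<close>
  have nodes: "pmf (sample_nodes CARD('a) (?B J) {}) Y = (\<Sum>f\<in>?F. if J = f ` Y then ?G f else 0)" for J
  proof (cases "card Y = card J")
    case True
    have "(\<Prod>i\<in>Y. indicator J (f i)) = (if J = f ` Y then 1 else (0::real))" if "inj_on f Y" for f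
    proof (cases "f ` Y \<subseteq> J")
      case sub: True
      have "f ` Y = J"
        by (rule card_subset_eq[OF _ sub]) (simp_all add: card_image[OF that] True)
      then show ?thesis by auto
    next
      case False
      then show ?thesis by (auto intro!: prod_zero simp: indicator_def)
    qed
    then have "principal_minor (span_projection (?B J)) Y = (\<Sum>f\<in>?F. if J = f ` Y then ?G f else 0)"
      unfolding span_projection_columns[OF V] principal_minor_spectral
      by (intro sum.cong refl) simp
    then show ?thesis
      using True pmf_sample_nodes[OF orthonormal_columns[OF V], of J "CARD('a)" Y]
      by (simp add: card card_mono)
  next
    case False
    then have "J \<noteq> f ` Y" if "f \<in> ?F" for f
      using that by (auto simp: card_image)
    then show ?thesis
      using False pmf_sample_nodes[OF orthonormal_columns[OF V], of J "CARD('a)" Y]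
      by (simp add: card card_mono)
  qed
  have "map_pmf snd (spectral_sampler V lam) =
      bind_pmf (select_modes lam) (\<lambda>J. sample_nodes CARD('a) (?B J) {})"
    by (simp add: spectral_sampler_def map_bind_pmf pmf.map_comp o_def)
  then have "pmf (map_pmf snd (spectral_sampler V lam)) Y =
      (\<Sum>J\<in>UNIV. (\<Sum>f\<in>?F. if J = f ` Y then ?G f else 0) * pmf (select_modes lam) J)"
    by (simp add: pmf_bind integral_measure_pmf_real[of UNIV] nodes)
  also have "\<dots> = (\<Sum>f\<in>?F. \<Sum>J\<in>UNIV. if J = f ` Y then ?G f * pmf (select_modes lam) J else 0)"
    unfolding sum_distrib_right by (subst sum.swap) (intro sum.cong refl, simp)
  \<comment> \<open>The probability of the surviving \<open>J\<close> supplies the weights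
    \<open>lam (f i)\<close> that the minor of \<open>L\<close> carries in its own
    expansion.\<close>
  also have "\<dots> = (\<Sum>f\<in>?F. (\<Prod>i\<in>Y. lam (f i)) * ?G f / ?D)"
    by (intro sum.cong refl) (simp add: pmf_select_modes[OF lam] prod.reindex)
  also have "\<dots> = principal_minor L Y / det (L + mat 1)"
    unfolding D unfolding L principal_minor_spectral sum_divide_distrib ..
  finally show ?thesis .
qed

text \<open>The masses of \<open>dpp L\<close> are values of a pmf; nonnegativity of the minors and
  total mass 1 come from here.\<close>

corollary spectral_sampler_eq_dpp:
  assumes "orthogonal_matrix V" "\<And>i. 0 \<le> lam i" "L = V ** diag_matrix lam ** transpose V"
  shows "measure_pmf (map_pmf snd (spectral_sampler V lam)) = dpp L"
  unfolding dpp_def point_measure_def measure_pmf_eq_density pmf_spectral_sampler_nodes[OF assms] ..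

section \<open>Mean and variance of the number of modes\<close>

lemma expectation_card_select_modes:
  assumes "\<And>i. 0 \<le> lam i"
  shows "measure_pmf.expectation (select_modes lam) (\<lambda>J. real (card J)) =
    (\<Sum>i\<in>UNIV. lam i / (lam i + 1))"
proof -
  have "real (card J) = (\<Sum>i\<in>UNIV. indicator {J. {i} \<subseteq> J} J)" for J :: "'a set"
    by (simp add: indicator_def sum.If_cases)
  then have "measure_pmf.expectation (select_modes lam) (\<lambda>J. real (card J)) =
      (\<Sum>i\<in>UNIV. measure_pmf.prob (select_modes lam) {J. {i} \<subseteq> J})"
    by (simp add: Bochner_Integration.integral_sum integrable_measure_pmf_finite del: insert_subset)
  then show ?thesis
    unfolding prob_select_modes_superset[OF assms] by simp
qed

lemma variance_card_select_modes:
  assumes "\<And>i. 0 \<le> lam i"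
  shows "measure_pmf.variance (select_modes lam) (\<lambda>J. real (card J)) =
    (\<Sum>i\<in>UNIV. lam i / (lam i + 1)\<^sup>2)"
proof -
  let ?k = "\<lambda>i. lam i / (lam i + 1)"
  have "(real (card J))\<^sup>2 = (\<Sum>i\<in>UNIV. \<Sum>j\<in>UNIV. indicator {J. {i, j} \<subseteq> J} J)" for J :: "'a set"
  proof -
    have "(real (card J))\<^sup>2 = (\<Sum>i\<in>UNIV. of_bool (i \<in> J)) * (\<Sum>i\<in>UNIV. of_bool (i \<in> J))"
      by (simp add: power2_eq_square of_bool_def sum.If_cases)
    then show ?thesis
      unfolding sum_product by (simp add: indicator_def of_bool_def[symmetric] flip: of_bool_conj)
  qed
  then have "measure_pmf.expectation (select_modes lam) (\<lambda>J. (real (card J))\<^sup>2) =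
      (\<Sum>i\<in>UNIV. \<Sum>j\<in>UNIV. measure_pmf.prob (select_modes lam) {J. {i, j} \<subseteq> J})"
    by (simp add: Bochner_Integration.integral_sum integrable_measure_pmf_finite del: insert_subset)
  \<comment> \<open>On the diagonal \<open>{i, j}\<close> is a singleton of probability
    \<open>?k i\<close> instead of the square, hence the correction term, which is the variance of
    one coin.\<close>
  also have "\<dots> = (\<Sum>i\<in>UNIV. \<Sum>j\<in>UNIV. ?k i * ?k j + (if j = i then ?k i - (?k i)\<^sup>2 else 0))"
    unfolding prob_select_modes_superset[OF assms]
    by (intro sum.cong refl) (auto simp: power2_eq_square)
  also have "\<dots> = (\<Sum>i\<in>UNIV. ?k i)\<^sup>2 + (\<Sum>i\<in>UNIV. ?k i - (?k i)\<^sup>2)"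
    by (simp only: sum.distrib power2_eq_square sum_product) simp
  also have "(\<Sum>i\<in>UNIV. ?k i - (?k i)\<^sup>2) = (\<Sum>i\<in>UNIV. lam i / (lam i + 1)\<^sup>2)"
  proof (intro sum.cong refl)
    fix i
    have "lam i + 1 \<noteq> 0" using assms[of i] by simp
    then show "?k i - (?k i)\<^sup>2 = lam i / (lam i + 1)\<^sup>2"
      by (simp add: power2_eq_square divide_simps) (simp add: algebra_simps)
  qed
  finally show ?thesis
    by (subst measure_pmf.variance_eq)
       (simp_all add: integrable_measure_pmf_finite expectation_card_select_modes[OF assms])
qed

section \<open>Kernel, inclusion probabilities and size of the sample\<close>

theorem theorem2:
  fixes A L V K :: "real^'n::{finite,linorder}^'n::{finite,linorder}"
    and lam :: "'n \<Rightarrow> real" and N :: nat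
  assumes "N \<ge> 1"
    and "L = observability_gramian A (mat 1) N"
    and "orthogonal_matrix V"
    and "L = V ** diag_matrix lam ** transpose V"
    and "\<And>i j. i \<le> j \<Longrightarrow> lam j \<le> lam i"
    and "\<And>i. 0 \<le> lam i"
    and "K = marginal_kernel L"
  shows
    "K = V ** diag_matrix (\<lambda>i. lam i / (lam i + 1)) ** transpose V
     \<and> prob_space (dpp L)
     \<and> (\<forall>i. K $ i $ i = measure (dpp L) {Y. i \<in> Y})
     \<and> (\<forall>i. K *v column i V = (lam i / (lam i + 1)) *s column i V)
     \<and> (\<forall>i. lam i / (lam i + 1) \<in> {0..<1})
     \<and> measure_pmf (map_pmf snd (spectral_sampler V lam)) = dpp L
     \<and> (\<forall>i. measure_pmf.prob (spectral_sampler V lam) {(J, Y). i \<in> J} = lam i / (lam i + 1))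
     \<and> prob_space.indep_events (measure_pmf (spectral_sampler V lam)) (\<lambda>i. {(J, Y). i \<in> J}) UNIV
     \<and> prob_space.expectation (dpp L) (\<lambda>Y. real (card Y)) = trace K
     \<and> trace K = (\<Sum>i\<in>UNIV. lam i / (lam i + 1))
     \<and> prob_space.variance (dpp L) (\<lambda>Y. real (card Y)) = (\<Sum>i\<in>UNIV. lam i / (lam i + 1)\<^sup>2)"
proof -
  note V = assms(3) and L = assms(4) and lam = assms(6)
  let ?p = "spectral_sampler V lam"
  let ?q = "map_pmf snd ?p"
  note dpp = spectral_sampler_eq_dpp[OF V lam L]
  have nz: "lam i + 1 \<noteq> 0" "lam i \<noteq> - 1" for i using lam[of i] by auto
  have K: "K = V ** diag_matrix (\<lambda>i. lam i / (lam i + 1)) ** transpose V"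
    unfolding assms(7) L by (rule marginal_kernel_spectral[OF V nz(2)])
  have trace: "trace K = (\<Sum>i\<in>UNIV. lam i / (lam i + 1))"
    unfolding K by (rule trace_conjugate_diag_matrix[OF V])
  have "K ** (L + mat 1) = L"
    unfolding K L conjugate_diag_matrix_add_mat_1[OF V] conjugate_diag_matrix_mult[OF V]
    by (simp add: nz)
  note minors = sum_principal_minor_not_containing[OF this]
  have "det (L + mat 1) = (\<Prod>i\<in>UNIV. lam i + 1)"
    unfolding L conjugate_diag_matrix_add_mat_1[OF V] by (rule det_conjugate_diag_matrix[OF V])
  then have D: "det (L + mat 1) \<noteq> 0" by (simp add: nz)
  have diag: "K $ i $ i = measure (dpp L) {Y. i \<in> Y}" for i
  proof -
    \<comment> \<open>The minor identity computes the complementary event.\<close>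
    have "measure_pmf.prob ?q {Y. i \<notin> Y} = 1 - K $ i $ i"
      using minors[of i] D
      by (simp add: measure_measure_pmf_finite pmf_spectral_sampler_nodes[OF V lam L]
          del: measure_map_pmf flip: sum_divide_distrib)
    moreover have "{Y. i \<notin> Y} = UNIV - {Y. i \<in> Y}" by auto
    ultimately show ?thesis
      unfolding dpp[symmetric] using measure_pmf.prob_compl[of "{Y. i \<in> Y}" ?q] by simp
  qed
  have modes: "measure_pmf.prob ?p {(J, Y). F \<subseteq> J} = (\<Prod>i\<in>F. lam i / (lam i + 1))" for F
  proof -
    have "measure_pmf.prob ?p {(J, Y). F \<subseteq> J} = measure_pmf.prob (map_pmf fst ?p) {J. F \<subseteq> J}"
      by (auto intro!: arg_cong2[where f=measure])
    then show ?thesis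
      unfolding map_fst_spectral_sampler prob_select_modes_superset[OF lam] .
  qed
  have mode: "measure_pmf.prob ?p {(J, Y). i \<in> J} = lam i / (lam i + 1)" for i
    using modes[of "{i}"] by simp
  have indep: "prob_space.indep_events (measure_pmf ?p) (\<lambda>i. {(J, Y). i \<in> J}) UNIV"
  proof (rule prob_space.indep_eventsI[OF prob_space_measure_pmf])
    fix F :: "'n set"
    \<comment> \<open>A joint selection event is again a superset event, whose probability factors
      by \<open>modes\<close>.\<close>
    have "(\<Inter>i\<in>F. {(J, Y). i \<in> J}) = {(J :: 'n set, Y :: 'n set). F \<subseteq> J}" by auto
    then show "measure_pmf.prob ?p (\<Inter>i\<in>F. {(J, Y). i \<in> J}) =
        (\<Prod>i\<in>F. measure_pmf.prob ?p {(J, Y). i \<in> J})"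
      by (simp only: mode modes)
  qed simp
  have "map_pmf (\<lambda>z. card (snd z)) ?p = map_pmf (\<lambda>z. card (fst z)) ?p"
    by (rule map_pmf_cong) (auto dest: card_spectral_sampler[OF V])
  then have card: "map_pmf card ?q = map_pmf card (select_modes lam)"
    by (simp add: pmf.map_comp o_def flip: map_fst_spectral_sampler[of V lam])
  \<comment> \<open>A general \<open>g\<close> covers both the mean and the squared
    deviation.\<close>
  have transfer: "measure_pmf.expectation ?q (\<lambda>Y. g (card Y)) =
      measure_pmf.expectation (select_modes lam) (\<lambda>J. g (card J))" for g :: "nat \<Rightarrow> real"
    using arg_cong[OF card, of "\<lambda>M. measure_pmf.expectation M g"]
    unfolding integral_map_pmf .
  have E: "measure_pmf.expectation ?q (\<lambda>Y. real (card Y)) = (\<Sum>i\<in>UNIV. lam i / (lam i + 1))"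
    by (simp only: transfer expectation_card_select_modes[OF lam])
  have Var: "measure_pmf.variance ?q (\<lambda>Y. real (card Y)) = (\<Sum>i\<in>UNIV. lam i / (lam i + 1)\<^sup>2)"
    unfolding E using variance_card_select_modes[OF lam]
    by (simp only: transfer[of "\<lambda>c. (real c - _)\<^sup>2"] expectation_card_select_modes[OF lam])
  have "prob_space (dpp L)"
    unfolding dpp[symmetric] by (rule prob_space_measure_pmf)
  moreover have "lam i / (lam i + 1) \<in> {0..<1}" for i
    using lam[of i] by (simp add: field_simps)
  moreover have "K *v column i V = (lam i / (lam i + 1)) *s column i V" for i
    unfolding K by (rule conjugate_diag_matrix_mult_column[OF V])
  ultimately show ?thesis
    using K diag dpp mode indep trace E[unfolded dpp] Var[unfolded dpp]
    by (simp only: trace) blast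
qed

end
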